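(* Let $G=(\mathcal V,\mathcal E)$ be a connected matching graph. Let $\mathrm{Pol}$ be the set of matching policies on $G$ and let $\mathrm{ML}$ be the "Match the Longest" policy. Then: \begin{enumerate} \item[(i)] $G$ is non-bipartite if and only if there exist $\Phi\in\mathrm{Pol}$ and $\mu\in \mathrm{Ncond}(G)$ such that the matching model $(G,\Phi,\mu)$ is stable. \item[(ii)] If $G$ is non-bipartite, then for every $\mu\in\mathrm{Ncond}(G)$ the matching model $(G,\mathrm{ML},\mu)$ is stable. \item[(iii)] If $G$ is separable of order $p$ for some $p\ge 3$, then for every $\Phi\in\mathrm{Pol}$ and every $\mu\in\mathrm{Ncond}(G)$ the matching model $(G,\Phi,\mu)$ is stable. \end{enumerate}
   Context: Graphs are finite, simple (no loops) and undirected, with non-empty vertex set $\mathcal V$; $u\sim v$ means that $u$ and $v$ are adjacent. For $U\subset\mathcal V$, $\mathcal E(U)=\{v\in\mathcal V : \exists u\in U,\ u\sim v\}$ and $\mathcal E(u)=\mathcal E(\{u\})$. An independent set is a non-empty subset of $\mathcal V$ containing no pair of adjacent vertices; $\mathbb I$ is the set of independent sets of $G$. $\mathcal M^+(\mathcal V)$ is the set of probability measures $\mu$ on $\mathcal V$ with $\mu(i)>0$ for all $i\in\mathcal V$. $\mathrm{Ncond}(G)$ is the set of $\mu\in\mathcal M^+(\mathcal V)$ such that $\mu(\mathcal I)<\mu(\mathcal E(\mathcal I))$ for all $\mathcal I\in\mathbb I$. Separable graph: $G$ is separable of order $p\ge2$ if $\mathcal V$ can be partitioned into independent sets $\mathcal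 I_1,\dots,\mathcal I_p$ such that for all $i\ne j$, all $u\in\mathcal I_i$ and all $v\in\mathcal I_j$, $u\sim v$. Matching model: let $\mathcal V^*$ be the set of finite words over $\mathcal V$, $|u|_i$ the number of occurrences of the letter $i$ in the word $u$, and $\mathbf 0$ the empty word. The state space of buffer-contents is $\mathcal U=\{u\in\mathcal V^* : |u|_i\,|u|_j=0 \text{ whenever } i\sim j\}$ (items stored in order of arrival). A matching policy is a mapping $\Phi:\mathcal U\times\mathcal V\to\mathcal U$, where $\Phi(u,v)$ is the new buffer-content after the arrival of an item of class $v$ in a buffer of content $u$, obeying the rule: if no letter $j$ of $u$ satisfies $v\sim j$, then $v$ is added to the buffer ($v$ is appended at the end of $u$); otherwise $v$ is not added and exactly one item of $u$, of some class $j$ with $v\sim j$, is removed from $u$, the choice of this item being specified by the policy as a function of $(u,v)$. Given $\mu\in\mathcal M^+(\mathcal V)$, let $(v_n)_{n\in\mathbb N}$ be i.i.d. with law $\mu$, and set $U_0=\mathbf 0$, $U_{n+1}=\Phi(U_n,v_n)$. The matching model $(G,\Phi,\mu)$ is stable if the Markov chain $(U_n)_{n\in\mathbb N}$ is positive recurrent. For policies depending only on the numbers of items of each class in the buffer, one may equivalently consider the Markov chain of the vectors $[U_n]=(|U_n|_i)_{i\in\mathcal V}\in\mathbb N^{\mathcal V}$. Match the Longest (ML): fix a total order on $\mathcal V$. When an item of class $i$ arrives and the buffer contains at least one item of a class in $\mathcal E(i)$, the removed item has class $j$, where $j$ is the largest element, for the fixed total order, of the set of classes $k\in\mathcal E(i)$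 whose number of items in the buffer is maximal among the classes of $\mathcal E(i)$. *)

theory Defs
  imports "HOL-Probability.Probability" "Graph_Theory.Digraph_Component" "Graph_Theory.Pair_Digraph"
begin

text \<open>
  A finite simple undirected graph is a \<open>pair_graph\<close>: a finite set of vertices \<open>pverts G\<close>
  with a symmetric irreflexive set of arcs \<open>parcs G\<close>, so that \<open>u \<sim> v\<close> is
  \<open>(u, v) \<in> parcs G\<close>. Connectedness is that of the graph library, and it
  includes that there is at least one vertex.
\<close>

definition neighbours :: "'a pair_pre_digraph \<Rightarrow> 'a set \<Rightarrow> 'a set" where
  "neighbours G U = {v \<in> pverts G. \<exists>u\<in>U. (u, v) \<in> parcs G}"

definition independent_set :: "'a pair_pre_digraph \<Rightarrow> 'a set \<Rightarrow> bool" where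
  "independent_set G I \<longleftrightarrow>
     I \<noteq> {} \<and> I \<subseteq> pverts G \<and> (\<forall>u\<in>I. \<forall>v\<in>I. (u, v) \<notin> parcs G)"

text \<open>One of the two classes may be empty, so that the one-vertex graph is bipartite.\<close>

definition bipartite :: "'a pair_pre_digraph \<Rightarrow> bool" where
  "bipartite G \<longleftrightarrow>
     (\<exists>A B. A \<union> B = pverts G \<and> A \<inter> B = {} \<and>
        (\<forall>u\<in>A. \<forall>v\<in>A. (u, v) \<notin> parcs G) \<and>
        (\<forall>u\<in>B. \<forall>v\<in>B. (u, v) \<notin> parcs G))"

definition separable :: "'a pair_pre_digraph \<Rightarrow> nat \<Rightarrow> bool" where
  "separable G p \<longleftrightarrow> 2 \<le> p \<and>
     (\<exists>P. partition_on (pverts G) P \<and> card P = p \<and> (\<forall>I\<in>P. independent_set G I) \<and>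
        (\<forall>I\<in>P. \<forall>J\<in>P. I \<noteq> J \<longrightarrow> (\<forall>u\<in>I. \<forall>v\<in>J. (u, v) \<in> parcs G)))"

text \<open>
  A probability measure on the finite set of vertices charging every vertex is a probability
  mass function whose support is exactly the set of vertices.
\<close>

definition Ncond :: "'a pair_pre_digraph \<Rightarrow> 'a pmf set" where
  "Ncond G = {\<mu>. set_pmf \<mu> = pverts G \<and>
     (\<forall>I. independent_set G I \<longrightarrow>
        measure_pmf.prob \<mu> I < measure_pmf.prob \<mu> (neighbours G I))}"

text \<open>Buffer contents are words of vertices, the oldest item being the head of the list.\<close>

definition buffers :: "'a pair_pre_digraph \<Rightarrow> 'a list set" where
  "buffers G = {u \<in> lists (pverts G).
     \<forall>i\<in>pverts G. \<forall>j\<in>pverts G. (i, j) \<in> parcs G \<longrightarrow> count_list u i * count_list u j = 0}"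

definition remove_item :: "nat \<Rightarrow> 'a list \<Rightarrow> 'a list" where
  "remove_item n u = take n u @ drop (Suc n) u"

text \<open>Values of a policy outside \<open>buffers G \<times> pverts G\<close> are irrelevant and left arbitrary.\<close>

definition Pol :: "'a pair_pre_digraph \<Rightarrow> ('a list \<Rightarrow> 'a \<Rightarrow> 'a list) set" where
  "Pol G = {\<Phi>. \<forall>u\<in>buffers G. \<forall>v\<in>pverts G.
     \<Phi> u v \<in> buffers G \<and>
     (if \<exists>j\<in>set u. (v, j) \<in> parcs G
      then \<exists>n<length u. (v, u ! n) \<in> parcs G \<and> \<Phi> u v = remove_item n u
      else \<Phi> u v = u @ [v])}"

text \<open>
  In \<open>longest_class G r u i j\<close> the relation \<open>r\<close> is a (reflexive) total order on the vertices,
  with \<open>(k, j) \<in> r\<close> meaning that \<open>k\<close> is below \<open>j\<close>.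
\<close>

definition longest_class ::
  "'a pair_pre_digraph \<Rightarrow> 'a rel \<Rightarrow> 'a list \<Rightarrow> 'a \<Rightarrow> 'a \<Rightarrow> bool" where
  "longest_class G r u i j \<longleftrightarrow>
     (let C = {k \<in> neighbours G {i}. \<forall>l \<in> neighbours G {i}. count_list u l \<le> count_list u k}
      in j \<in> C \<and> (\<forall>k\<in>C. (k, j) \<in> r))"

text \<open>
  Match the Longest only prescribes the class of the removed item, not which of the items
  of that class is taken out of the word; \<open>Match_Longest G r\<close> therefore consists of all the
  word-level policies that implement it for the tie-breaking order \<open>r\<close>.
\<close>

definition Match_Longest :: "'a pair_pre_digraph \<Rightarrow> 'a rel \<Rightarrow> ('a list \<Rightarrow> 'a \<Rightarrow> 'a list) set" where
  "Match_Longest G r = {\<Phi> \<in> Pol G. \<forall>u\<in>buffers G. \<forall>i\<in>pverts G.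
     (\<exists>j\<in>set u. (i, j) \<in> parcs G) \<longrightarrow>
     (\<exists>n<length u. longest_class G r u i (u ! n) \<and> \<Phi> u i = remove_item n u)}"

text \<open>
  The buffer after \<open>n\<close> arrivals, for the sequence of arriving items \<open>\<omega>\<close> and the initial
  content \<open>u\<close>. Under \<open>stream_space (measure_pmf \<mu>)\<close> the coordinates
  \<open>\<omega> !! 0, \<omega> !! 1, \<dots>\<close> are i.i.d. with law \<open>\<mu>\<close>.
\<close>

primrec buffer :: "('a list \<Rightarrow> 'a \<Rightarrow> 'a list) \<Rightarrow> 'a list \<Rightarrow> 'a stream \<Rightarrow> nat \<Rightarrow> 'a list" where
  "buffer \<Phi> u \<omega> 0 = u"
| "buffer \<Phi> u \<omega> (Suc n) = \<Phi> (buffer \<Phi> u \<omega> n) (\<omega> !! n)"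

text \<open>The infimum of the empty set is \<open>\<infinity>\<close>: no return to \<open>u\<close>.\<close>

definition return_time :: "('a list \<Rightarrow> 'a \<Rightarrow> 'a list) \<Rightarrow> 'a list \<Rightarrow> 'a stream \<Rightarrow> ennreal" where
  "return_time \<Phi> u \<omega> = (INF n\<in>{n. 1 \<le> n \<and> buffer \<Phi> u \<omega> n = u}. of_nat n)"

text \<open>
  Positive recurrence of the Markov chain on the state space \<open>buffers G\<close>: each
  state has finite mean return time. On a connected graph with at least two vertices the chain
  is irreducible (the empty buffer can be reached from everywhere, and the arrivals spelling
  \<open>u\<close> lead from it to \<open>u\<close>), so this does not depend on the initial state.
\<close>

definition stable_model :: "'a pair_pre_digraph \<Rightarrow> ('a list \<Rightarrow> 'a \<Rightarrow> 'a list) \<Rightarrow> 'a pmf \<Rightarrow> bool" where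
  "stable_model G \<Phi> \<mu> \<longleftrightarrow>
     (\<forall>u\<in>buffers G. (\<integral>\<^sup>+ \<omega>. return_time \<Phi> u \<omega> \<partial>stream_space (measure_pmf \<mu>)) < \<infinity>)"

end

theory Submission
  imports Defs
begin

text \<open>
  Stability follows from a Foster-Lyapunov argument. For Match the Longest the Lyapunov function is
  \<open>\<Sum>i. (count_list u i)\<^sup>2\<close>: whether or not an arriving item of class \<open>v\<close> is matched, its
  increment is \<open>1 + 2 x\<^sub>v - 2 max\<^bsub>k \<sim> v\<^esub> x\<^sub>k\<close>, where \<open>x\<^sub>i = count_list u i\<close>,
  and \<open>Ncond\<close> applied to the level sets of \<open>x\<close> bounds the mean of this by \<open>1 - 2 \<delta> max x\<close>.
  On a separable graph all items of a nonempty buffer lie in a single class \<open>I\<close> of the partition,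
  every arrival outside \<open>I\<close> is matched, and the length of the buffer has mean increment
  \<open>\<mu>(I) - \<mu>(\<E>(I)) < 0\<close>, whatever the policy. Finally, \<open>Ncond\<close> is empty for a bipartite graph,
  since each class would have to be lighter than the other one, and contains the degree
  distribution for a connected non-bipartite one.
\<close>

section \<open>A drift criterion for finite mean return times\<close>

text \<open>The times are \<open>1, \<dots>, n\<close>: starting at \<open>z\<close> does not count as a visit.\<close>

primrec avoid_prob :: "('s \<Rightarrow> 'a \<Rightarrow> 's) \<Rightarrow> 'a pmf \<Rightarrow> 's \<Rightarrow> nat \<Rightarrow> 's \<Rightarrow> real" where
  "avoid_prob \<Phi> \<mu> z 0 x = 1"
| "avoid_prob \<Phi> \<mu> z (Suc n) x =
     (\<Sum>v\<in>set_pmf \<mu>. pmf \<mu> v * (if \<Phi> x v = z then 0 else avoid_prob \<Phi> \<mu> z n (\<Phi> x v)))"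

lemma avoid_prob_nonneg: "0 \<le> avoid_prob \<Phi> \<mu> z n x"
  by (induction n arbitrary: x) (auto intro!: sum_nonneg)

lemma avoid_prob_le_1:
  assumes fin: "finite (set_pmf \<mu>)"
  shows "avoid_prob \<Phi> \<mu> z n x \<le> 1"
proof (induction n arbitrary: x)
  case (Suc n)
  have "avoid_prob \<Phi> \<mu> z (Suc n) x \<le> (\<Sum>v\<in>set_pmf \<mu>. pmf \<mu> v)"
    unfolding avoid_prob.simps by (intro sum_mono) (auto simp: Suc mult_left_le)
  then show ?case by (simp add: sum_pmf_eq_1[OF fin])
qed simp

lemma avoid_prob_Suc_le:
  assumes fin: "finite (set_pmf \<mu>)"
  shows "avoid_prob \<Phi> \<mu> z (Suc n) x \<le> avoid_prob \<Phi> \<mu> z n x"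
proof (induction n arbitrary: x)
  case 0
  show ?case using avoid_prob_le_1[OF fin, of \<Phi> z "Suc 0" x] by simp
next
  case (Suc n)
  show ?case
    unfolding avoid_prob.simps(2)[of _ _ _ n] avoid_prob.simps(2)[of _ _ _ "Suc n"]
    using Suc by (intro sum_mono mult_left_mono) auto
qed

lemma avoid_prob_antimono:
  assumes "finite (set_pmf \<mu>)" and "m \<le> n"
  shows "avoid_prob \<Phi> \<mu> z n x \<le> avoid_prob \<Phi> \<mu> z m x"
  using assms(2) avoid_prob_Suc_le[OF assms(1)]
  by (rule lift_Suc_antimono_le[where f = "\<lambda>n. avoid_prob \<Phi> \<mu> z n x", rotated])

text \<open>The letters of \<open>vs\<close> arrive in order with positive probability and lead to
  \<open>z\<close>. By induction the term of the first letter falls strictly below its weight, and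
  no other term exceeds its own, so the average stays below 1.\<close>

lemma avoid_prob_less_1:
  assumes fin: "finite (set_pmf \<mu>)"
    and "set vs \<subseteq> set_pmf \<mu>" "vs \<noteq> []" "foldl \<Phi> x vs = z"
  shows "avoid_prob \<Phi> \<mu> z (length vs) x < 1"
  using assms(2-)
proof (induction vs arbitrary: x)
  case (Cons v vs)
  let ?g = "\<lambda>w. if \<Phi> x w = z then 0 else avoid_prob \<Phi> \<mu> z (length vs) (\<Phi> x w)"
  have v: "v \<in> set_pmf \<mu>" using Cons.prems by simp
  have "?g v < 1"
  proof (cases "\<Phi> x v = z")
    case False
    then have "vs \<noteq> []" using Cons.prems by auto
    then show ?thesis using Cons False by simp
  qed simp
  then have "(\<Sum>w\<in>set_pmf \<mu>. pmf \<mu> w * ?g w) < (\<Sum>w\<in>set_pmf \<mu>. pmf \<mu> w)"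
    using v avoid_prob_le_1[OF fin]
    by (intro sum_strict_mono_ex1[OF fin] ballI bexI[of _ v])
       (auto simp: mult_left_le set_pmf_iff pmf_pos)
  then show ?case by (simp add: sum_pmf_eq_1[OF fin])
qed simp

text \<open>First-step analysis: the partial sums are truncated mean hitting times of
  \<open>z\<close> and obey the recursion of which \<open>W\<close> is a supersolution, so
  \<open>W\<close> dominates them for every \<open>n\<close>.\<close>

lemma sum_avoid_prob_le:
  assumes closed: "\<And>x v. x \<in> B \<Longrightarrow> v \<in> set_pmf \<mu> \<Longrightarrow> \<Phi> x v \<in> B"
    and nonneg: "\<And>x. x \<in> B \<Longrightarrow> 0 \<le> W x"
    and super: "\<And>x. x \<in> B \<Longrightarrow>
      1 + (\<Sum>v\<in>set_pmf \<mu>. pmf \<mu> v * (if \<Phi> x v = z then 0 else W (\<Phi> x v))) \<le> W x"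
    and "x \<in> B"
  shows "(\<Sum>k<n. avoid_prob \<Phi> \<mu> z k x) \<le> W x"
  using \<open>x \<in> B\<close>
proof (induction n arbitrary: x)
  case (Suc n)
  let ?S = "\<lambda>y. \<Sum>k<n. avoid_prob \<Phi> \<mu> z k y"
  have "(\<Sum>k<Suc n. avoid_prob \<Phi> \<mu> z k x) = 1 + (\<Sum>k<n. avoid_prob \<Phi> \<mu> z (Suc k) x)"
    by (simp only: sum.lessThan_Suc_shift avoid_prob.simps(1))
  also have "(\<Sum>k<n. avoid_prob \<Phi> \<mu> z (Suc k) x) =
      (\<Sum>v\<in>set_pmf \<mu>. \<Sum>k<n. pmf \<mu> v * (if \<Phi> x v = z then 0 else avoid_prob \<Phi> \<mu> z k (\<Phi> x v)))"
    unfolding avoid_prob.simps by (rule sum.swap)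
  also have "\<dots> = (\<Sum>v\<in>set_pmf \<mu>. pmf \<mu> v * (if \<Phi> x v = z then 0 else ?S (\<Phi> x v)))"
    by (intro sum.cong) (auto simp: sum_distrib_left)
  also have "\<dots> \<le> (\<Sum>v\<in>set_pmf \<mu>. pmf \<mu> v * (if \<Phi> x v = z then 0 else W (\<Phi> x v)))"
    using Suc closed by (intro sum_mono mult_left_mono) auto
  also have "1 + \<dots> \<le> W x" using super Suc.prems by blast
  finally show ?case by simp
qed (use nonneg in auto)

text \<open>
  With \<open>h x = (\<Sum>k<m. avoid_prob \<Phi> \<mu> z k x)\<close>, one step of the chain killed at \<open>z\<close> decreases \<open>h\<close>
  by the probability of visiting \<open>z\<close> within \<open>m\<close> steps. Adding a large multiple of \<open>h\<close> to the
  Lyapunov function compensates for the lack of negative drift on the finite set \<open>F\<close>.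
\<close>

lemma sum_avoid_prob_bounded:
  fixes f :: "'s \<Rightarrow> real"
  assumes fin: "finite (set_pmf \<mu>)"
    and closed: "\<And>x v. x \<in> B \<Longrightarrow> v \<in> set_pmf \<mu> \<Longrightarrow> \<Phi> x v \<in> B"
    and f_nonneg: "\<And>x. x \<in> B \<Longrightarrow> 0 \<le> f x"
    and "0 < \<epsilon>" and "finite F"
    and drift: "\<And>x. x \<in> B - F \<Longrightarrow> (\<Sum>v\<in>set_pmf \<mu>. pmf \<mu> v * f (\<Phi> x v)) \<le> f x - \<epsilon>"
    and reach: "\<And>x. x \<in> F \<Longrightarrow> \<exists>vs. vs \<noteq> [] \<and> set vs \<subseteq> set_pmf \<mu> \<and> foldl \<Phi> x vs = z"
    and "x \<in> B"
  shows "\<exists>c\<ge>0. \<forall>n. (\<Sum>k<n. avoid_prob \<Phi> \<mu> z k x) \<le> c"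
proof -
  let ?E = "\<lambda>g x. \<Sum>v\<in>set_pmf \<mu>. pmf \<mu> v * (g (\<Phi> x v) :: real)"
  let ?K = "\<lambda>g x. \<Sum>v\<in>set_pmf \<mu>. pmf \<mu> v * (if \<Phi> x v = z then 0 else (g (\<Phi> x v) :: real))"
  have "\<exists>n. avoid_prob \<Phi> \<mu> z n x < 1" if x: "x \<in> F" for x
  proof -
    obtain vs where "vs \<noteq> []" "set vs \<subseteq> set_pmf \<mu>" "foldl \<Phi> x vs = z" using reach[OF x] by blast
    then have "avoid_prob \<Phi> \<mu> z (length vs) x < 1" by (intro avoid_prob_less_1[OF fin])
    then show ?thesis ..
  qed
  then obtain N where N: "\<And>x. x \<in> F \<Longrightarrow> avoid_prob \<Phi> \<mu> z (N x) x < 1" by metis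
  \<comment> \<open>A common horizon for all states of \<open>F\<close>: it is at least every
    \<open>N x\<close>, and a longer horizon only lowers the avoidance probability.\<close>
  define m where "m = (\<Sum>x\<in>F. N x)"
  have m: "avoid_prob \<Phi> \<mu> z m x < 1" if "x \<in> F" for x
  proof -
    have "N x \<le> m" unfolding m_def using \<open>finite F\<close> that by (simp add: member_le_sum)
    then show ?thesis using avoid_prob_antimono[OF fin] N[OF that] by (meson le_less_trans)
  qed
  define h where "h x = (\<Sum>k<m. avoid_prob \<Phi> \<mu> z k x)" for x
  have h_nonneg: "0 \<le> h x" for x
    unfolding h_def by (intro sum_nonneg avoid_prob_nonneg)
  have Kh: "?K h x = h x - (1 - avoid_prob \<Phi> \<mu> z m x)" for x
  proof -
    have "?K h x =
        (\<Sum>v\<in>set_pmf \<mu>. \<Sum>k<m. pmf \<mu> v * (if \<Phi> x v = z then 0 else avoid_prob \<Phi> \<mu> z k (\<Phi> x v)))"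
      by (intro sum.cong) (auto simp: h_def sum_distrib_left)
    also have "\<dots> = (\<Sum>k<m. avoid_prob \<Phi> \<mu> z (Suc k) x)"
      unfolding avoid_prob.simps by (rule sum.swap)
    also have "\<dots> = (\<Sum>k<Suc m. avoid_prob \<Phi> \<mu> z k x) - 1"
      by (simp only: sum.lessThan_Suc_shift avoid_prob.simps(1))
    finally show ?thesis by (simp add: h_def)
  qed
  \<comment> \<open>Scaling \<open>f\<close> by \<open>a\<close> turns the drift
    \<open>- \<epsilon>\<close> outside \<open>F\<close> into -1, which pays for the unit of elapsed
    time.\<close>
  define a where "a = 1 / \<epsilon>"
  have "a > 0" "a * \<epsilon> = 1" using \<open>0 < \<epsilon>\<close> by (auto simp: a_def)
  \<comment> \<open>\<open>q x\<close> is the multiple of \<open>h\<close> that absorbs this unit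
    and a possible upward drift of \<open>f\<close> at \<open>x\<close>. Being nonnegative on
    \<open>F\<close>, these add up to a multiple \<open>M\<close> that works on all of
    \<open>F\<close>.\<close>
  define q where "q x = (1 + a * \<bar>?E f x - f x\<bar>) / (1 - avoid_prob \<Phi> \<mu> z m x)" for x
  define M where "M = (\<Sum>x\<in>F. q x)"
  have q_nonneg: "0 \<le> q x" if "x \<in> F" for x
    unfolding q_def using m[OF that] \<open>a > 0\<close> by (intro divide_nonneg_nonneg add_nonneg_nonneg) auto
  have "M \<ge> 0" unfolding M_def by (intro sum_nonneg q_nonneg)
  define W where "W x = a * f x + M * h x" for x
  have W_nonneg: "0 \<le> W x" if "x \<in> B" for x
    using f_nonneg[OF that] h_nonneg[of x] \<open>a > 0\<close> \<open>M \<ge> 0\<close> by (simp add: W_def)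
  have KW: "?K W x \<le> W x + a * (?E f x - f x) - M * (1 - avoid_prob \<Phi> \<mu> z m x)" if "x \<in> B" for x
  proof -
    have "?K W x = a * ?K f x + M * ?K h x"
      by (auto simp: W_def sum_distrib_left algebra_simps sum.distrib[symmetric] intro!: sum.cong)
    moreover have "?K f x \<le> ?E f x"
      using closed[OF that] f_nonneg by (intro sum_mono mult_left_mono) auto
    ultimately have "?K W x \<le> a * ?E f x + M * ?K h x"
      using \<open>a > 0\<close> by (simp add: mult_left_mono)
    also have "\<dots> = W x + a * (?E f x - f x) - M * (1 - avoid_prob \<Phi> \<mu> z m x)"
      unfolding Kh by (simp add: W_def algebra_simps)
    finally show ?thesis .
  qed
  have super: "1 + ?K W x \<le> W x" if "x \<in> B" for x
  proof (cases "x \<in> F")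
    case True
    have "q x \<le> M"
      unfolding M_def using \<open>finite F\<close> True q_nonneg by (intro member_le_sum) auto
    then have "1 + a * \<bar>?E f x - f x\<bar> \<le> M * (1 - avoid_prob \<Phi> \<mu> z m x)"
      using m[OF True] by (simp add: q_def pos_divide_le_eq)
    moreover have "a * (?E f x - f x) \<le> a * \<bar>?E f x - f x\<bar>"
      using \<open>a > 0\<close> by (intro mult_left_mono) auto
    ultimately show ?thesis using KW[OF that] by linarith
  next
    case False
    then have "?E f x - f x \<le> - \<epsilon>" using drift[of x] that by simp
    then have "a * (?E f x - f x) \<le> a * (- \<epsilon>)" using \<open>a > 0\<close> by (intro mult_left_mono) auto
    moreover have "0 \<le> M * (1 - avoid_prob \<Phi> \<mu> z m x)"
      using \<open>M \<ge> 0\<close> avoid_prob_le_1[OF fin, of \<Phi> z m x] by simp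
    ultimately show ?thesis using KW[OF that] \<open>a * \<epsilon> = 1\<close> by simp
  qed
  show ?thesis
    using sum_avoid_prob_le[where W = W and B = B and \<Phi> = \<Phi> and \<mu> = \<mu> and z = z,
        OF closed W_nonneg super \<open>x \<in> B\<close>] W_nonneg[OF \<open>x \<in> B\<close>]
    by blast
qed

text \<open>
  Arrivals are replaced through \<open>c\<close>, which has finite range, because the path of the chain need not
  be measurable when the type of the letters is uncountable.
\<close>

primrec avoids :: "('s \<Rightarrow> 'a \<Rightarrow> 's) \<Rightarrow> ('a \<Rightarrow> 'a) \<Rightarrow> 's \<Rightarrow> nat \<Rightarrow> 's \<Rightarrow> 'a stream \<Rightarrow> bool" where
  "avoids \<Phi> c z 0 x \<omega> \<longleftrightarrow> True"
| "avoids \<Phi> c z (Suc n) x \<omega> \<longleftrightarrow>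
     \<Phi> x (c (shd \<omega>)) \<noteq> z \<and> avoids \<Phi> c z n (\<Phi> x (c (shd \<omega>))) (stl \<omega>)"

text \<open>The next state depends on the stream only through \<open>c (shd \<omega>)\<close>, which
  takes finitely many values; each value leaves an event of the shifted stream.\<close>

lemma measurable_avoids:
  assumes "finite (range c)"
  shows "Measurable.pred (stream_space (measure_pmf \<mu>)) (avoids \<Phi> c z n x)"
proof (induction n arbitrary: x)
  case (Suc n)
  let ?M = "stream_space (measure_pmf \<mu>)"
  have [measurable]: "Measurable.pred ?M (\<lambda>\<omega>. avoids \<Phi> c z n y (stl \<omega>))" for y
    using measurable_compose[OF measurable_stl Suc] .
  have "(\<lambda>\<omega>. c (shd \<omega>)) \<in> ?M \<rightarrow>\<^sub>M count_space (range c)"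
    by (rule measurable_compose[OF measurable_shd]) simp
  moreover have "Measurable.pred ?M (\<lambda>\<omega>. \<Phi> x v \<noteq> z \<and> avoids \<Phi> c z n (\<Phi> x v) (stl \<omega>))" for v
    by measurable
  ultimately have "Measurable.pred ?M
      (\<lambda>\<omega>. \<Phi> x (c (shd \<omega>)) \<noteq> z \<and> avoids \<Phi> c z n (\<Phi> x (c (shd \<omega>))) (stl \<omega>))"
    using measurable_compose_countable'[where I = "range c" and g = "\<lambda>\<omega>. c (shd \<omega>)"
        and f = "\<lambda>v \<omega>. \<Phi> x v \<noteq> z \<and> avoids \<Phi> c z n (\<Phi> x v) (stl \<omega>)"]
      countable_finite[OF assms] by blast
  then show ?case by simp
qed (simp add: avoids.simps(1)[abs_def])

text \<open>Conditioning on the first arrival reproduces the recursion of \<open>avoid_prob\<close>: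
  the tail is independent of the head and again a stream of the same law, and \<open>c\<close> is
  the identity on the support.\<close>

lemma nn_integral_avoids:
  assumes fin: "finite (set_pmf \<mu>)" and c: "finite (range c)" "\<And>v. v \<in> set_pmf \<mu> \<Longrightarrow> c v = v"
  shows "(\<integral>\<^sup>+ \<omega>. indicator {\<omega>. avoids \<Phi> c z n x \<omega>} \<omega> \<partial>stream_space (measure_pmf \<mu>))
    = ennreal (avoid_prob \<Phi> \<mu> z n x)"
proof (induction n arbitrary: x)
  case 0
  interpret prob_space "stream_space (measure_pmf \<mu>)"
    by (rule prob_space.prob_space_stream_space[OF prob_space_measure_pmf])
  show ?case by (simp add: emeasure_space_1)
next
  case (Suc n)
  let ?M = "stream_space (measure_pmf \<mu>)"
  have meas [measurable]: "Measurable.pred ?M (avoids \<Phi> c z k y)" for k y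
    by (rule measurable_avoids[OF c(1)])
  have "(\<integral>\<^sup>+ \<omega>. indicator {\<omega>. avoids \<Phi> c z (Suc n) x \<omega>} \<omega> \<partial>?M) =
      (\<integral>\<^sup>+ v. (\<integral>\<^sup>+ \<omega>. indicator {\<omega>. avoids \<Phi> c z (Suc n) x \<omega>} (v ## \<omega>) \<partial>?M) \<partial>measure_pmf \<mu>)"
    by (rule prob_space.nn_integral_stream_space[OF prob_space_measure_pmf]) (use meas[of "Suc n" x] in measurable)
  also have "\<dots> = (\<Sum>v\<in>set_pmf \<mu>.
      (\<integral>\<^sup>+ \<omega>. indicator {\<omega>. avoids \<Phi> c z (Suc n) x \<omega>} (v ## \<omega>) \<partial>?M) * ennreal (pmf \<mu> v))"
    by (rule nn_integral_measure_pmf_finite[OF fin]) simp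
  also have "\<dots> = (\<Sum>v\<in>set_pmf \<mu>.
      ennreal (pmf \<mu> v * (if \<Phi> x v = z then 0 else avoid_prob \<Phi> \<mu> z n (\<Phi> x v))))"
  proof (rule sum.cong)
    fix v assume v: "v \<in> set_pmf \<mu>"
    have "(\<integral>\<^sup>+ \<omega>. indicator {\<omega>. avoids \<Phi> c z (Suc n) x \<omega>} (v ## \<omega>) \<partial>?M) =
        (\<integral>\<^sup>+ \<omega>. (if \<Phi> x v = z then 0 else indicator {\<omega>. avoids \<Phi> c z n (\<Phi> x v) \<omega>} \<omega>) \<partial>?M)"
      by (intro nn_integral_cong) (auto simp: indicator_def c(2)[OF v])
    also have "\<dots> = ennreal (if \<Phi> x v = z then 0 else avoid_prob \<Phi> \<mu> z n (\<Phi> x v))"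
      using Suc by simp
    finally show "(\<integral>\<^sup>+ \<omega>. indicator {\<omega>. avoids \<Phi> c z (Suc n) x \<omega>} (v ## \<omega>) \<partial>?M) * ennreal (pmf \<mu> v)
        = ennreal (pmf \<mu> v * (if \<Phi> x v = z then 0 else avoid_prob \<Phi> \<mu> z n (\<Phi> x v)))"
      by (simp add: ennreal_mult' mult.commute avoid_prob_nonneg)
  qed simp
  also have "\<dots> = ennreal (avoid_prob \<Phi> \<mu> z (Suc n) x)"
    by (simp add: sum_ennreal avoid_prob_nonneg)
  finally show ?case .
qed

text \<open>\<open>buffer\<close> recurses on the last arrival and \<open>avoids\<close> on the
  first; this shift reconciles the two.\<close>

lemma buffer_Suc_shift: "buffer \<Phi> u \<omega> (Suc n) = buffer \<Phi> (\<Phi> u (shd \<omega>)) (stl \<omega>) n"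
  by (induction n arbitrary: u \<omega>) simp_all

lemma avoids_iff_buffer:
  assumes "stream_all (\<lambda>v. c v = v) \<omega>"
  shows "avoids \<Phi> c z n x \<omega> \<longleftrightarrow> (\<forall>k\<in>{1..n}. buffer \<Phi> x \<omega> k \<noteq> z)"
  using assms
proof (induction n arbitrary: x \<omega>)
  case (Suc n)
  have "c (\<omega> !! 0) = \<omega> !! 0" using Suc.prems unfolding stream_all_def by blast
  then have c: "c (shd \<omega>) = shd \<omega>" by simp
  have "c (stl \<omega> !! k) = stl \<omega> !! k" for k
    using Suc.prems[unfolded stream_all_def, THEN spec, of "Suc k"] by simp
  then have "stream_all (\<lambda>v. c v = v) (stl \<omega>)" unfolding stream_all_def by blast
  then have "avoids \<Phi> c z (Suc n) x \<omega> \<longleftrightarrow>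
      buffer \<Phi> x \<omega> 1 \<noteq> z \<and> (\<forall>k\<in>{1..n}. buffer \<Phi> x \<omega> (Suc k) \<noteq> z)"
    using Suc.IH by (simp add: c buffer_Suc_shift del: buffer.simps(2))
  also have "\<dots> \<longleftrightarrow> (\<forall>k\<in>{1..Suc n}. buffer \<Phi> x \<omega> k \<noteq> z)"
  proof -
    have *: "{1..Suc n} = insert 1 (Suc ` {1..n})" by (auto simp: image_iff)
    show ?thesis unfolding * by blast
  qed
  finally show ?case .
qed simp

text \<open>Tail-sum formula: the indicator of index \<open>n\<close> says that the return comes
  after time \<open>n\<close>. A first return at time \<open>n\<close> gives ones at the indices
  \<open>0, ..., n - 1\<close>; without a return all terms are 1 and the series diverges.\<close>

lemma return_time_le:
  assumes "stream_all (\<lambda>v. c v = v) \<omega>"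
  shows "return_time \<Phi> u \<omega> \<le> (\<Sum>n. indicator {\<omega>. avoids \<Phi> c u n u \<omega>} \<omega>)"
proof (cases "\<exists>n\<ge>1. buffer \<Phi> u \<omega> n = u")
  case True
  define n where "n = (LEAST n. 1 \<le> n \<and> buffer \<Phi> u \<omega> n = u)"
  have n: "1 \<le> n \<and> buffer \<Phi> u \<omega> n = u"
    unfolding n_def using True by (rule LeastI_ex)
  have "avoids \<Phi> c u k u \<omega>" if "k < n" for k
    unfolding avoids_iff_buffer[OF assms]
    using that not_less_Least[of _ "\<lambda>n. 1 \<le> n \<and> buffer \<Phi> u \<omega> n = u"] unfolding n_def by force
  then have "(of_nat n :: ennreal) = (\<Sum>k<n. indicator {\<omega>. avoids \<Phi> c u k u \<omega>} \<omega>)"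
    by simp
  also have "\<dots> \<le> (\<Sum>n. indicator {\<omega>. avoids \<Phi> c u n u \<omega>} \<omega>)"
    by (rule sum_le_suminf) auto
  finally show ?thesis
    unfolding return_time_def using n by (intro INF_lower2[of n]) auto
next
  case False
  then have "(\<Sum>n. indicator {\<omega>. avoids \<Phi> c u n u \<omega>} \<omega>) = (\<Sum>n. 1 :: ennreal)"
    using avoids_iff_buffer[OF assms] by (intro suminf_cong) auto
  also have "\<dots> = \<infinity>"
    by (simp add: suminf_eq_SUP ennreal_SUP_of_nat_eq_top)
  finally show ?thesis by simp
qed

text \<open>Foster's criterion: the mean return time is bounded by the series of avoidance
  probabilities, whose partial sums the drift keeps bounded.\<close>

theorem finite_mean_return_time:
  fixes f :: "'a list \<Rightarrow> real"
  assumes fin: "finite (set_pmf \<mu>)"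
    and closed: "\<And>x v. x \<in> B \<Longrightarrow> v \<in> set_pmf \<mu> \<Longrightarrow> \<Phi> x v \<in> B"
    and "\<And>x. x \<in> B \<Longrightarrow> 0 \<le> f x"
    and "0 < \<epsilon>" and "finite F"
    and "\<And>x. x \<in> B - F \<Longrightarrow> (\<Sum>v\<in>set_pmf \<mu>. pmf \<mu> v * f (\<Phi> x v)) \<le> f x - \<epsilon>"
    and "\<And>x. x \<in> F \<Longrightarrow> \<exists>vs. vs \<noteq> [] \<and> set vs \<subseteq> set_pmf \<mu> \<and> foldl \<Phi> x vs = u"
    and "u \<in> B"
  shows "(\<integral>\<^sup>+ \<omega>. return_time \<Phi> u \<omega> \<partial>stream_space (measure_pmf \<mu>)) < \<infinity>"
proof -
  let ?M = "stream_space (measure_pmf \<mu>)"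
  obtain b where b: "b \<ge> 0" "\<And>n. (\<Sum>k<n. avoid_prob \<Phi> \<mu> u k u) \<le> b"
    using sum_avoid_prob_bounded[where B = B and \<Phi> = \<Phi> and \<mu> = \<mu>, OF assms] by blast
  obtain v0 where "v0 \<in> set_pmf \<mu>" using set_pmf_not_empty by fast
  \<comment> \<open>Letters outside the support are collapsed to one letter of it, which gives a
    finite range; almost surely no arrival is affected.\<close>
  define c where "c v = (if v \<in> set_pmf \<mu> then v else v0)" for v
  have "range c \<subseteq> set_pmf \<mu>" using \<open>v0 \<in> set_pmf \<mu>\<close> by (auto simp: c_def)
  then have c: "finite (range c)" using fin finite_subset by blast
  have [measurable]: "Measurable.pred ?M (avoids \<Phi> c u k u)" for k
    by (rule measurable_avoids[OF c(1)])
  have "AE v in measure_pmf \<mu>. c v = v" by (simp add: AE_measure_pmf_iff c_def)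
  then have "AE \<omega> in ?M. stream_all (\<lambda>v. c v = v) \<omega>"
    by (intro prob_space.AE_stream_all[OF prob_space_measure_pmf]) simp_all
  then have "AE \<omega> in ?M. return_time \<Phi> u \<omega> \<le> (\<Sum>n. indicator {\<omega>. avoids \<Phi> c u n u \<omega>} \<omega>)"
    by eventually_elim (rule return_time_le)
  then have "(\<integral>\<^sup>+ \<omega>. return_time \<Phi> u \<omega> \<partial>?M) \<le>
      (\<integral>\<^sup>+ \<omega>. (\<Sum>n. indicator {\<omega>. avoids \<Phi> c u n u \<omega>} \<omega>) \<partial>?M)"
    by (rule nn_integral_mono_AE)
  also have "\<dots> = (\<Sum>n. \<integral>\<^sup>+ \<omega>. indicator {\<omega>. avoids \<Phi> c u n u \<omega>} \<omega> \<partial>?M)"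
    by (rule nn_integral_suminf) measurable
  also have "\<dots> = (\<Sum>n. ennreal (avoid_prob \<Phi> \<mu> u n u))"
    by (subst nn_integral_avoids[OF fin c]) (auto simp: c_def)
  also have "\<dots> \<le> ennreal b"
    using b by (auto simp: suminf_eq_SUP sum_ennreal avoid_prob_nonneg intro!: SUP_least ennreal_leI)
  also have "\<dots> < \<infinity>" by simp
  finally show ?thesis .
qed

section \<open>Matching models\<close>

lemma set_remove_item: "set (remove_item n u) \<subseteq> set u"
  unfolding remove_item_def by (auto dest: in_set_takeD in_set_dropD)

lemma count_list_remove_item:
  assumes "n < length u"
  shows "count_list u j = count_list (remove_item n u) j + of_bool (u ! n = j)"
  by (subst id_take_nth_drop[OF assms]) (simp add: remove_item_def)

lemma length_remove_item: "n < length u \<Longrightarrow> length u = Suc (length (remove_item n u))"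
  by (simp add: remove_item_def)

lemma linear_order_on_finite_greatest:
  assumes "linear_order_on A r" "finite C" "C \<noteq> {}" "C \<subseteq> A"
  shows "\<exists>j\<in>C. \<forall>k\<in>C. (k, j) \<in> r"
  using assms(2-)
proof (induction C rule: finite_ne_induct)
  case (singleton x)
  then show ?case using assms(1)
    by (auto simp: order_on_defs refl_on_def)
next
  case (insert x C)
  then obtain j where j: "j \<in> C" "\<forall>k\<in>C. (k, j) \<in> r" by auto
  have r: "trans r" "refl_on A r" "total_on A r" using assms(1) by (auto simp: order_on_defs)
  have "x \<in> A" "j \<in> A" using insert j by auto
  show ?case
  proof (cases "(x, j) \<in> r")
    case True
    then show ?thesis using j by auto
  next
    case False
    then have "(j, x) \<in> r" using r \<open>x \<in> A\<close> \<open>j \<in> A\<close>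
      by (cases "x = j") (auto simp: refl_on_def total_on_def)
    moreover have "(x, x) \<in> r" using r \<open>x \<in> A\<close> by (auto simp: refl_on_def)
    moreover have "(k, x) \<in> r" if "k \<in> C" for k
      using transD[OF r(1)] j(2) that calculation(1) by blast
    ultimately show ?thesis by blast
  qed
qed

lemma sum_change_one:
  fixes g h :: "'a \<Rightarrow> 'b :: ab_group_add"
  assumes "finite V" "j \<in> V" "\<And>i. i \<in> V \<Longrightarrow> i \<noteq> j \<Longrightarrow> g i = h i"
  shows "sum g V = sum h V - h j + g j"
proof -
  have "sum g (V - {j}) = sum h (V - {j})" using assms(3) by (intro sum.cong) auto
  then show ?thesis by (simp add: sum.remove[OF assms(1,2)])
qed

text \<open>Layer-cake formula. The common bound \<open>N\<close> lets all vertices share one range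
  of levels, so that sums over vertices and levels can be exchanged.\<close>

lemma real_eq_sum_levels:
  assumes "c \<le> N"
  shows "real c = (\<Sum>t\<in>{1..N}. of_bool (t \<le> c))"
proof -
  have "(\<Sum>t\<in>{1..N}. of_bool (t \<le> c) :: real) = (\<Sum>t\<in>{1..c}. 1)"
    using assms by (intro sum.mono_neutral_cong_right) auto
  then show ?thesis by simp
qed

lemma prob_eq_sum_of_bool:
  assumes "finite (set_pmf \<mu>)"
  shows "measure_pmf.prob \<mu> A = (\<Sum>v\<in>set_pmf \<mu>. pmf \<mu> v * of_bool (v \<in> A))"
proof -
  have "measure_pmf.prob \<mu> A = measure_pmf.prob \<mu> (A \<inter> set_pmf \<mu>)"
    by (simp add: measure_Int_set_pmf)
  also have "\<dots> = (\<Sum>v\<in>A \<inter> set_pmf \<mu>. pmf \<mu> v)"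
    using assms by (simp add: measure_measure_pmf_finite)
  also have "\<dots> = (\<Sum>v\<in>set_pmf \<mu>. pmf \<mu> v * of_bool (v \<in> A))"
    using assms by (intro sum.mono_neutral_cong_left) auto
  finally show ?thesis .
qed

section \<open>Neighbourhoods, buffers and policies\<close>

lemma (in pair_graph) arc_sym: "(u, v) \<in> parcs G \<Longrightarrow> (v, u) \<in> parcs G"
  using pair_sym_arcs by (auto simp: symmetric_def dest: symD)

lemma (in pair_graph) in_neighbours_iff:
  "v \<in> neighbours G U \<longleftrightarrow> (\<exists>u\<in>U. (u, v) \<in> parcs G)"
  unfolding neighbours_def using in_arcsD2 by auto

lemma (in pair_graph) finite_neighbours: "finite (neighbours G U)"
  using pair_finite_verts by (simp add: neighbours_def)

lemma (in pair_graph) in_buffers_iff: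
  "u \<in> buffers G \<longleftrightarrow> set u \<subseteq> pverts G \<and> (\<forall>i\<in>set u. \<forall>j\<in>set u. (i, j) \<notin> parcs G)"
  unfolding buffers_def by (auto simp: count_list_0_iff dest: in_arcsD1 in_arcsD2)

lemma (in pair_graph) Pol_cases:
  assumes "\<Phi> \<in> Pol G" "u \<in> buffers G" "v \<in> pverts G"
  obtains (appended) "\<forall>j\<in>set u. (v, j) \<notin> parcs G" "\<Phi> u v = u @ [v]"
  | (matched) n where "n < length u" "(v, u ! n) \<in> parcs G" "\<Phi> u v = remove_item n u"
proof (cases "\<exists>j\<in>set u. (v, j) \<in> parcs G")
  case True
  then have "\<exists>n<length u. (v, u ! n) \<in> parcs G \<and> \<Phi> u v = remove_item n u"
    using assms by (simp add: Pol_def)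
  then show ?thesis using matched by blast
next
  case False
  then have "\<Phi> u v = u @ [v]" using assms by (simp add: Pol_def)
  then show ?thesis using appended False by blast
qed

lemma Pol_closed: "\<Phi> \<in> Pol G \<Longrightarrow> u \<in> buffers G \<Longrightarrow> v \<in> pverts G \<Longrightarrow> \<Phi> u v \<in> buffers G"
  by (auto simp: Pol_def)

lemma (in pair_graph) Ncond_neighbours_nonempty:
  assumes "\<mu> \<in> Ncond G" "v \<in> pverts G"
  shows "neighbours G {v} \<noteq> {}"
proof -
  have "independent_set G {v}"
    using assms pair_no_loops[of "(v, v)"] by (auto simp: independent_set_def)
  then have "measure_pmf.prob \<mu> {v} < measure_pmf.prob \<mu> (neighbours G {v})"
    using assms by (auto simp: Ncond_def)
  then show ?thesis by (metis measure_empty measure_nonneg not_less)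
qed

text \<open>There are only finitely many independent sets, so the positive gaps in
  \<open>Ncond\<close> are bounded away from 0.\<close>

lemma (in pair_graph) Ncond_margin:
  assumes "\<mu> \<in> Ncond G"
  obtains \<delta> where "\<delta> > 0"
    "\<And>I. independent_set G I \<Longrightarrow>
       measure_pmf.prob \<mu> I + \<delta> \<le> measure_pmf.prob \<mu> (neighbours G I)"
proof -
  let ?d = "\<lambda>I. measure_pmf.prob \<mu> (neighbours G I) - measure_pmf.prob \<mu> I"
  \<comment> \<open>The extra 1 keeps the set nonempty for \<open>Min\<close>.\<close>
  let ?D = "insert 1 (?d ` {I. independent_set G I})"
  have "{I. independent_set G I} \<subseteq> Pow (pverts G)" by (auto simp: independent_set_def)
  then have fin: "finite ?D" using pair_finite_verts finite_subset by blast
  have "Min ?D > 0"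
    using fin assms by (subst Min_gr_iff) (auto simp: Ncond_def)
  moreover have "measure_pmf.prob \<mu> I + Min ?D \<le> measure_pmf.prob \<mu> (neighbours G I)"
    if "independent_set G I" for I
    using Min_le[OF fin, of "?d I"] that by auto
  ultimately show ?thesis using that by blast
qed

text \<open>The arrival of a neighbour of a stored item is always matched and shortens the buffer;
  \<open>Ncond\<close> guarantees that such a neighbour exists.\<close>

lemma (in pair_graph) drain_buffer:
  assumes "\<Phi> \<in> Pol G" "\<mu> \<in> Ncond G" "u \<in> buffers G"
  shows "\<exists>vs. set vs \<subseteq> pverts G \<and> foldl \<Phi> u vs = []"
  using assms(3)
proof (induction u rule: length_induct)
  case (1 u)
  show ?case
  proof (cases u)
    case Nil
    then show ?thesis by (intro exI[of _ "[]"]) simp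
  next
    case (Cons i u')
    then have "i \<in> pverts G" using 1 by (simp add: in_buffers_iff)
    then obtain w where w: "(i, w) \<in> parcs G" "w \<in> pverts G"
      using Ncond_neighbours_nonempty[OF assms(2)] in_arcsD2 by (fastforce simp: in_neighbours_iff)
    have "length (\<Phi> u w) < length u"
      using assms(1) \<open>u \<in> buffers G\<close> w(2)
    proof (cases rule: Pol_cases)
      case appended
      then show ?thesis using arc_sym[OF w(1)] Cons by simp
    next
      case (matched n)
      then show ?thesis using length_remove_item by fastforce
    qed
    then obtain vs where "set vs \<subseteq> pverts G" "foldl \<Phi> (\<Phi> u w) vs = []"
      using 1 Pol_closed[OF assms(1) _ w(2)] by blast
    then show ?thesis using w by (intro exI[of _ "w # vs"]) simp
  qed
qed

text \<open>No two letters of an admissible word are adjacent, so arrivals spelling it are never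
  matched, whatever the policy.\<close>

lemma (in pair_graph) fill_buffer:
  assumes "\<Phi> \<in> Pol G" "z \<in> buffers G"
  shows "foldl \<Phi> [] z = z"
  using assms(2)
proof (induction z rule: rev_induct)
  case (snoc v z)
  have z: "z \<in> buffers G" "v \<in> pverts G" using snoc.prems by (auto simp: in_buffers_iff)
  have "\<Phi> z v = z @ [v]"
    using assms(1) z
  proof (cases rule: Pol_cases)
    case (matched n)
    then show ?thesis using snoc.prems nth_mem[of n z] by (auto simp: in_buffers_iff)
  qed
  then show ?case using snoc.IH z by simp
qed simp

text \<open>Every state is accessible from any state by way of the empty buffer, so Foster's
  criterion applies to each return state.\<close>

lemma (in pair_graph) stable_if_drift:
  fixes f :: "'a list \<Rightarrow> real"
  assumes \<Phi>: "\<Phi> \<in> Pol G" and \<mu>: "\<mu> \<in> Ncond G"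
    and f: "\<And>u. u \<in> buffers G \<Longrightarrow> 0 \<le> f u" and \<epsilon>: "0 < \<epsilon>" and "finite F"
    and drift: "\<And>u. u \<in> buffers G \<Longrightarrow> u \<notin> F \<Longrightarrow>
      (\<Sum>v\<in>pverts G. pmf \<mu> v * f (\<Phi> u v)) \<le> f u - \<epsilon>"
  shows "stable_model G \<Phi> \<mu>"
  unfolding stable_model_def
proof
  fix z assume z: "z \<in> buffers G"
  have V: "set_pmf \<mu> = pverts G" using \<mu> by (simp add: Ncond_def)
  obtain w where w: "w \<in> pverts G" using V set_pmf_not_empty[of \<mu>] by auto
  \<comment> \<open>The first arrival \<open>w\<close> makes the word nonempty even when
    \<open>u\<close> and \<open>z\<close> are both empty.\<close>
  have reach: "\<exists>vs. vs \<noteq> [] \<and> set vs \<subseteq> pverts G \<and> foldl \<Phi> u vs = z"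
    if u: "u \<in> buffers G" for u
  proof -
    obtain vs where "set vs \<subseteq> pverts G" "foldl \<Phi> (\<Phi> u w) vs = []"
      using drain_buffer[OF \<Phi> \<mu> Pol_closed[OF \<Phi> u w]] by blast
    then show ?thesis
      using fill_buffer[OF \<Phi> z] w z by (intro exI[of _ "w # vs @ z"]) (auto simp: in_buffers_iff)
  qed
  show "(\<integral>\<^sup>+ \<omega>. return_time \<Phi> z \<omega> \<partial>stream_space (measure_pmf \<mu>)) < \<infinity>"
  proof (rule finite_mean_return_time[where B = "buffers G" and f = f and \<epsilon> = \<epsilon>
        and F = "F \<inter> buffers G"])
    show "finite (set_pmf \<mu>)" using V pair_finite_verts by simp
    show "\<Phi> x v \<in> buffers G" if "x \<in> buffers G" "v \<in> set_pmf \<mu>" for x v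
      using Pol_closed[OF \<Phi>] that V by simp
  qed (use f \<epsilon> \<open>finite F\<close> drift reach z V in auto)
qed

section \<open>Match the Longest\<close>

text \<open>Supplies the policy for the existence claim: a position holding an item of the
  prescribed class is picked by choice.\<close>

lemma (in pair_graph) Match_Longest_nonempty:
  assumes r: "linear_order_on (pverts G) r"
  shows "Match_Longest G r \<noteq> {}"
proof -
  define \<Phi> where "\<Phi> u i =
    (if \<exists>j\<in>set u. (i, j) \<in> parcs G
     then remove_item (SOME n. n < length u \<and> longest_class G r u i (u ! n)) u
     else u @ [i])" for u i
  have longest: "\<exists>n<length u. longest_class G r u i (u ! n) \<and> (i, u ! n) \<in> parcs G
      \<and> \<Phi> u i = remove_item n u"
    if "\<exists>j\<in>set u. (i, j) \<in> parcs G" for u i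
  proof -
    from that obtain j where j: "j \<in> set u" "j \<in> neighbours G {i}"
      by (auto simp: in_neighbours_iff)
    define C where
      "C = {k \<in> neighbours G {i}. \<forall>l \<in> neighbours G {i}. count_list u l \<le> count_list u k}"
    have "Max (count_list u ` neighbours G {i}) \<in> count_list u ` neighbours G {i}"
      using finite_neighbours j by (intro Max_in) auto
    then obtain k where "k \<in> neighbours G {i}"
        "count_list u k = Max (count_list u ` neighbours G {i})"
      by auto
    then have "k \<in> C" using finite_neighbours by (auto simp: C_def)
    moreover have "finite C" "C \<subseteq> pverts G"
      using finite_neighbours by (auto simp: C_def neighbours_def)
    ultimately obtain k where k: "k \<in> C" "\<forall>l\<in>C. (l, k) \<in> r"
      using linear_order_on_finite_greatest[OF r] by blast
    \<comment> \<open>The stored class \<open>j\<close> has positive count, hence so does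
      \<open>k\<close>, and an item of class \<open>k\<close> is there to be removed.\<close>
    have "count_list u j \<le> count_list u k" using k(1) j by (auto simp: C_def)
    then have "k \<in> set u" using j(1) by (metis count_list_0_iff le_zero_eq)
    then have "\<exists>n. n < length u \<and> longest_class G r u i (u ! n)"
      using k by (auto simp: in_set_conv_nth longest_class_def C_def)
    then have n: "(SOME n. n < length u \<and> longest_class G r u i (u ! n)) < length u \<and>
        longest_class G r u i (u ! (SOME n. n < length u \<and> longest_class G r u i (u ! n)))"
      by (rule someI_ex)
    moreover have "(i, l) \<in> parcs G" if "longest_class G r u i l" for l
      using that by (auto simp: longest_class_def in_neighbours_iff Let_def)
    ultimately show ?thesis using that unfolding \<Phi>_def by auto
  qed
  have "\<Phi> u v \<in> buffers G" if "u \<in> buffers G" "v \<in> pverts G" for u v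
  proof (cases "\<exists>j\<in>set u. (v, j) \<in> parcs G")
    case True
    then obtain n where "\<Phi> u v = remove_item n u" using longest by blast
    then show ?thesis using that set_remove_item[of n u] by (auto simp: in_buffers_iff)
  next
    case False
    then have "\<Phi> u v = u @ [v]" by (simp add: \<Phi>_def)
    then show ?thesis
      using that False arc_sym pair_no_loops[of "(v, v)"] by (auto simp: in_buffers_iff)
  qed
  moreover have "\<Phi> u v = u @ [v]" if "\<not> (\<exists>j\<in>set u. (v, j) \<in> parcs G)" for u v
    using that by (simp add: \<Phi>_def)
  ultimately have "\<Phi> \<in> Pol G"
    unfolding Pol_def using longest by (simp add: Bex_def) blast
  then have "\<Phi> \<in> Match_Longest G r"
    unfolding Match_Longest_def using longest by blast
  then show ?thesis by blast
qed

text \<open>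
  Slicing the buffer into its levels \<open>I\<^sub>t = {v. t \<le> count_list u v}\<close>, which are independent sets, turns
  the difference of the means into a sum of differences between \<open>I\<^sub>t\<close> and its neighbours.
\<close>

lemma (in pair_graph) mean_longest_neighbour:
  assumes \<mu>: "\<mu> \<in> Ncond G" and u: "u \<in> buffers G"
    and \<delta>: "\<And>I. independent_set G I \<Longrightarrow>
       measure_pmf.prob \<mu> I + \<delta> \<le> measure_pmf.prob \<mu> (neighbours G I)"
    and i: "i \<in> pverts G" and max: "\<And>v. v \<in> pverts G \<Longrightarrow> count_list u v \<le> count_list u i"
  shows "(\<Sum>v\<in>pverts G. pmf \<mu> v * real (count_list u v)) + \<delta> * real (count_list u i)
    \<le> (\<Sum>v\<in>pverts G. pmf \<mu> v * real (Max (count_list u ` neighbours G {v})))"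
proof -
  let ?c = "count_list u"
  let ?I = "\<lambda>t. {v \<in> pverts G. t \<le> ?c v}"
  let ?P = "measure_pmf.prob \<mu>"
  have V: "set_pmf \<mu> = pverts G" using \<mu> by (simp add: Ncond_def)
  have fin: "finite (set_pmf \<mu>)" using V pair_finite_verts by simp
  have ne: "neighbours G {v} \<noteq> {}" if "v \<in> pverts G" for v using Ncond_neighbours_nonempty[OF \<mu> that] .
  \<comment> \<open>Applied to the counts and to the neighbourhood maxima; both are bounded by the
    largest count \<open>?c i\<close>, so both are sliced into the same levels.\<close>
  have slice: "(\<Sum>v\<in>pverts G. pmf \<mu> v * real (g v)) = (\<Sum>t\<in>{1..?c i}. ?P {v \<in> pverts G. t \<le> g v})"
    if g: "\<And>v. v \<in> pverts G \<Longrightarrow> g v \<le> ?c i" for g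
  proof -
    have "(\<Sum>v\<in>pverts G. pmf \<mu> v * real (g v)) =
        (\<Sum>v\<in>pverts G. \<Sum>t\<in>{1..?c i}. pmf \<mu> v * of_bool (t \<le> g v))"
      by (intro sum.cong) (simp_all add: real_eq_sum_levels[OF g] sum_distrib_left)
    also have "\<dots> = (\<Sum>t\<in>{1..?c i}. \<Sum>v\<in>pverts G. pmf \<mu> v * of_bool (t \<le> g v))"
      by (rule sum.swap)
    also have "\<dots> = (\<Sum>t\<in>{1..?c i}. ?P {v \<in> pverts G. t \<le> g v})"
      unfolding prob_eq_sum_of_bool[OF fin] V by (intro sum.cong) auto
    finally show ?thesis .
  qed
  have "(\<Sum>v\<in>pverts G. pmf \<mu> v * real (?c v)) + \<delta> * real (?c i) = (\<Sum>t\<in>{1..?c i}. ?P (?I t) + \<delta>)"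
    by (simp add: slice max sum.distrib)
  also have "\<dots> \<le> (\<Sum>t\<in>{1..?c i}. ?P {v \<in> pverts G. t \<le> Max (?c ` neighbours G {v})})"
  proof (rule sum_mono)
    fix t assume t: "t \<in> {1..?c i}"
    \<comment> \<open>Levels start at 1, so a level contains only stored classes, which are pairwise
      nonadjacent; it contains \<open>i\<close>, so it is not empty.\<close>
    have "?I t \<subseteq> set u"
    proof
      fix v assume "v \<in> ?I t"
      then have "?c v \<noteq> 0" using t by auto
      then show "v \<in> set u" by (simp add: count_list_0_iff)
    qed
    moreover have "i \<in> ?I t" using t i by simp
    ultimately have "independent_set G (?I t)"
      using u unfolding independent_set_def in_buffers_iff by blast
    then have "?P (?I t) + \<delta> \<le> ?P (neighbours G (?I t))" by (rule \<delta>)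
    \<comment> \<open>A vertex has a neighbour in the level exactly when its longest neighbouring
      class reaches height \<open>t\<close>.\<close>
    moreover have "neighbours G (?I t) = {v \<in> pverts G. t \<le> Max (?c ` neighbours G {v})}"
    proof -
      have "t \<le> Max (?c ` neighbours G {v}) \<longleftrightarrow> (\<exists>w. (v, w) \<in> parcs G \<and> t \<le> ?c w)"
        if "v \<in> pverts G" for v
        using finite_neighbours ne[OF that]
        by (subst Max_ge_iff) (auto simp: in_neighbours_iff)
      then show ?thesis
        using arc_sym in_arcsD1 in_arcsD2 unfolding in_neighbours_iff set_eq_iff mem_Collect_eq
        by blast
    qed
    ultimately show "?P (?I t) + \<delta> \<le> ?P {v \<in> pverts G. t \<le> Max (?c ` neighbours G {v})}" by simp
  qed
  also have "\<dots> = (\<Sum>v\<in>pverts G. pmf \<mu> v * real (Max (?c ` neighbours G {v})))"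
    using finite_neighbours ne max by (subst slice) (auto simp: neighbours_def)
  finally show ?thesis .
qed

text \<open>If \<open>v\<close> is matched, its own count is 0 and the longest neighbouring class
  passes from \<open>m\<close> to \<open>m - 1\<close>, a change of \<open>1 - 2 * m\<close> in the
  squares. Otherwise the maximum is 0 and the class of \<open>v\<close> passes from \<open>x\<close>
  to \<open>x + 1\<close>, a change of \<open>1 + 2 * x\<close>.\<close>

lemma (in pair_graph) Match_Longest_sum_squares:
  assumes \<Phi>: "\<Phi> \<in> Match_Longest G r" and \<mu>: "\<mu> \<in> Ncond G"
    and u: "u \<in> buffers G" and v: "v \<in> pverts G"
  shows "(\<Sum>i\<in>pverts G. (real (count_list (\<Phi> u v) i))\<^sup>2) =
    (\<Sum>i\<in>pverts G. (real (count_list u i))\<^sup>2) + 1 + 2 * real (count_list u v)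
      - 2 * real (Max (count_list u ` neighbours G {v}))"
proof (cases "\<exists>j\<in>set u. (v, j) \<in> parcs G")
  case True
  then obtain n where n: "n < length u" "longest_class G r u v (u ! n)" "\<Phi> u v = remove_item n u"
    using \<Phi> u v by (auto simp: Match_Longest_def)
  let ?j = "u ! n"
  have j: "?j \<in> neighbours G {v}" "\<And>l. l \<in> neighbours G {v} \<Longrightarrow> count_list u l \<le> count_list u ?j"
    using n(2) by (auto simp: longest_class_def Let_def)
  then have Max: "Max (count_list u ` neighbours G {v}) = count_list u ?j"
    using finite_neighbours by (intro Max_eqI) auto
  have "v \<notin> set u" using True u by (auto simp: in_buffers_iff)
  then have 0: "count_list u v = 0" by (simp add: count_list_0_iff)
  have "?j \<in> pverts G" using j(1) by (simp add: neighbours_def)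
  then have "(\<Sum>i\<in>pverts G. (real (count_list (\<Phi> u v) i))\<^sup>2) =
      (\<Sum>i\<in>pverts G. (real (count_list u i))\<^sup>2) - (real (count_list u ?j))\<^sup>2
        + (real (count_list (\<Phi> u v) ?j))\<^sup>2"
    using pair_finite_verts n(3) count_list_remove_item[OF n(1)] by (intro sum_change_one) auto
  moreover have "real (count_list u ?j) = real (count_list (\<Phi> u v) ?j) + 1"
    using n(3) count_list_remove_item[OF n(1), of ?j] by simp
  ultimately show ?thesis unfolding Max 0 by (simp add: power2_eq_square algebra_simps)
next
  case False
  then have app: "\<Phi> u v = u @ [v]" using \<Phi> u v by (auto simp: Match_Longest_def Pol_def)
  have "count_list u l = 0" if "l \<in> neighbours G {v}" for l
    using that False by (auto simp: in_neighbours_iff count_list_0_iff)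
  then have Max: "Max (count_list u ` neighbours G {v}) = 0"
    using Ncond_neighbours_nonempty[OF \<mu> v] finite_neighbours by (intro Max_eqI) force+
  have "(\<Sum>i\<in>pverts G. (real (count_list (\<Phi> u v) i))\<^sup>2) =
      (\<Sum>i\<in>pverts G. (real (count_list u i))\<^sup>2) - (real (count_list u v))\<^sup>2
        + (real (count_list (\<Phi> u v) v))\<^sup>2"
    using pair_finite_verts v app by (intro sum_change_one) auto
  then show ?thesis unfolding Max by (simp add: app power2_eq_square algebra_simps)
qed

theorem (in pair_graph) Match_Longest_stable:
  assumes \<Phi>: "\<Phi> \<in> Match_Longest G r" and \<mu>: "\<mu> \<in> Ncond G"
  shows "stable_model G \<Phi> \<mu>"
proof -
  have V: "set_pmf \<mu> = pverts G" using \<mu> by (simp add: Ncond_def)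
  have sum1: "(\<Sum>v\<in>pverts G. pmf \<mu> v) = 1"
    using V pair_finite_verts by (intro sum_pmf_eq_1) auto
  obtain \<delta> where \<delta>: "\<delta> > 0" "\<And>I. independent_set G I \<Longrightarrow>
      measure_pmf.prob \<mu> I + \<delta> \<le> measure_pmf.prob \<mu> (neighbours G I)"
    using Ncond_margin[OF \<mu>] by blast
  \<comment> \<open>The mean increment is at most \<open>1 - 2 * \<delta> * m\<close> when the
    longest class has \<open>m\<close> items, hence at most -1 once \<open>m\<close> exceeds
    \<open>K\<close>.\<close>
  obtain K :: nat where K: "1 / \<delta> < real K" using reals_Archimedean2 by blast
  then have K: "1 \<le> \<delta> * real K" using \<delta>(1) by (simp add: field_simps)
  \<comment> \<open>By the pigeonhole principle, an admissible buffer outside \<open>F\<close> has a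
    class with more than \<open>K\<close> items.\<close>
  define F where "F = {u. set u \<subseteq> pverts G \<and> length u \<le> card (pverts G) * K}"
  let ?f = "\<lambda>u. \<Sum>i\<in>pverts G. (real (count_list u i))\<^sup>2"
  show ?thesis
  proof (rule stable_if_drift[where f = ?f and \<epsilon> = 1 and F = F])
    show "\<Phi> \<in> Pol G" using \<Phi> by (simp add: Match_Longest_def)
    show "finite F" unfolding F_def using pair_finite_verts by (rule finite_lists_length_le)
    fix u assume u: "u \<in> buffers G" "u \<notin> F"
    let ?c = "count_list u"
    have fin: "finite (?c ` pverts G)" and ne: "pverts G \<noteq> {}"
      using pair_finite_verts V set_pmf_not_empty[of \<mu>] by auto
    then have "Max (?c ` pverts G) \<in> ?c ` pverts G" by (intro Max_in) auto
    then obtain i where i: "i \<in> pverts G" "?c i = Max (?c ` pverts G)" by auto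
    have max: "?c v \<le> ?c i" if "v \<in> pverts G" for v
      unfolding i(2) using fin that by simp
    have "?c i > K"
    proof (rule ccontr)
      assume "\<not> K < ?c i"
      then have "sum ?c (pverts G) \<le> card (pverts G) * K"
        using max by (intro sum_bounded_above[of _ ?c K, simplified]) (meson le_trans not_less)
      moreover have "sum ?c (pverts G) = length u"
        using u pair_finite_verts by (intro sum_count_set) (auto simp: in_buffers_iff)
      ultimately show False using u by (auto simp: F_def in_buffers_iff)
    qed
    then have "\<delta> * real K \<le> \<delta> * real (?c i)" using \<delta>(1) by simp
    then have c_i: "1 \<le> \<delta> * real (?c i)" using K by simp
    let ?m = "\<lambda>v. Max (?c ` neighbours G {v})"
    have "(\<Sum>v\<in>pverts G. pmf \<mu> v * ?f (\<Phi> u v)) =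
        (\<Sum>v\<in>pverts G. pmf \<mu> v * (?f u + 1) + 2 * (pmf \<mu> v * real (?c v))
          - 2 * (pmf \<mu> v * real (?m v)))"
      by (intro sum.cong)
        (simp_all only: Match_Longest_sum_squares[OF \<Phi> \<mu> u(1)], simp add: algebra_simps)
    also have "\<dots> = ?f u + 1 + 2 * (\<Sum>v\<in>pverts G. pmf \<mu> v * real (?c v))
        - 2 * (\<Sum>v\<in>pverts G. pmf \<mu> v * real (?m v))"
      by (simp add: sum.distrib sum_subtractf sum_distrib_left[symmetric]
          sum_distrib_right[symmetric] sum1)
    also have "\<dots> \<le> ?f u - 1"
      using mean_longest_neighbour[OF \<mu> u(1) \<delta>(2) i(1) max] c_i by linarith
    finally show "(\<Sum>v\<in>pverts G. pmf \<mu> v * ?f (\<Phi> u v)) \<le> ?f u - 1" .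
  qed (use \<mu> in \<open>auto intro: sum_nonneg\<close>)
qed

section \<open>Separable graphs\<close>

theorem (in pair_graph) separable_stable:
  assumes sep: "separable G p" and \<Phi>: "\<Phi> \<in> Pol G" and \<mu>: "\<mu> \<in> Ncond G"
  shows "stable_model G \<Phi> \<mu>"
proof -
  have V: "set_pmf \<mu> = pverts G" using \<mu> by (simp add: Ncond_def)
  have fin: "finite (set_pmf \<mu>)" using V pair_finite_verts by simp
  have sum1: "(\<Sum>v\<in>pverts G. pmf \<mu> v) = 1"
    using V pair_finite_verts by (intro sum_pmf_eq_1) auto
  obtain P where P: "partition_on (pverts G) P" "\<forall>I\<in>P. independent_set G I"
    and complete: "\<forall>I\<in>P. \<forall>J\<in>P. I \<noteq> J \<longrightarrow> (\<forall>u\<in>I. \<forall>v\<in>J. (u, v) \<in> parcs G)"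
    using sep unfolding separable_def by (elim conjE exE)
  have cover: "\<Union>P = pverts G" using P(1) by (simp add: partition_on_def)
  obtain \<delta> where \<delta>: "\<delta> > 0" "\<And>I. independent_set G I \<Longrightarrow>
      measure_pmf.prob \<mu> I + \<delta> \<le> measure_pmf.prob \<mu> (neighbours G I)"
    using Ncond_margin[OF \<mu>] by blast
  show ?thesis
  \<comment> \<open>The same drift bound holds at every nonempty content, so only the empty buffer
    is exceptional.\<close>
  proof (rule stable_if_drift[OF \<Phi> \<mu>, where f = "\<lambda>u. real (length u)" and \<epsilon> = \<delta> and F = "{[]}"])
    fix u assume u: "u \<in> buffers G" "u \<notin> {[]}"
    then obtain i where i: "i \<in> set u" "i \<in> pverts G" by (cases u) (auto simp: in_buffers_iff)
    then obtain I where I: "I \<in> P" "i \<in> I" using cover by blast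
    have other: "(v, w) \<in> parcs G" if v: "v \<in> pverts G" "v \<notin> I" "w \<in> I" for v w
    proof -
      obtain J where "J \<in> P" "v \<in> J" using v(1) cover by blast
      then show ?thesis using complete I(1) v(2,3) by blast
    qed
    have sub: "set u \<subseteq> I"
    proof
      fix j assume "j \<in> set u"
      then show "j \<in> I" using other[of j i] i I u by (auto simp: in_buffers_iff)
    qed
    have ind: "independent_set G I" using P(2) I(1) by blast
    have nb: "neighbours G I = pverts G - I"
      using ind I(2) other arc_sym unfolding neighbours_def independent_set_def by blast
    \<comment> \<open>An arrival in \<open>I\<close> meets only nonadjacent items and is stored; an
      arrival outside \<open>I\<close> is adjacent to the stored item \<open>i\<close> and is
      matched.\<close>
    have step: "real (length (\<Phi> u v)) =
        real (length u) + of_bool (v \<in> I) - of_bool (v \<in> neighbours G I)"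
      if v: "v \<in> pverts G" for v
      using \<Phi> u(1) v
    proof (cases rule: Pol_cases)
      case appended
      then have "v \<in> I" using other[of v i] i I v by blast
      then show ?thesis using appended nb by simp
    next
      case (matched n)
      then have "u ! n \<in> I" using sub nth_mem by blast
      then have "v \<notin> I" using ind matched(2) by (auto simp: independent_set_def)
      then show ?thesis using matched nb v length_remove_item[of n u] by simp
    qed
    have "(\<Sum>v\<in>pverts G. pmf \<mu> v * real (length (\<Phi> u v))) =
        (\<Sum>v\<in>pverts G. pmf \<mu> v * real (length u) + pmf \<mu> v * of_bool (v \<in> I)
          - pmf \<mu> v * of_bool (v \<in> neighbours G I))"
      by (intro sum.cong) (simp_all only: step distrib_left right_diff_distrib)
    also have "\<dots> = real (length u) + measure_pmf.prob \<mu> I - measure_pmf.prob \<mu> (neighbours G I)"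
      unfolding prob_eq_sum_of_bool[OF fin] V
      by (simp only: sum.distrib sum_subtractf sum_distrib_right[symmetric] sum1 mult_1)
    also have "\<dots> \<le> real (length u) - \<delta>" using \<delta>(2)[OF ind] by simp
    finally show "(\<Sum>v\<in>pverts G. pmf \<mu> v * real (length (\<Phi> u v))) \<le> real (length u) - \<delta>" .
  qed (use \<delta>(1) in auto)
qed

section \<open>Bipartite graphs\<close>

lemma (in pair_graph) Ncond_bipartite:
  assumes "bipartite G" "\<mu> \<in> Ncond G"
  shows False
proof -
  obtain A B where AB: "A \<union> B = pverts G" "A \<inter> B = {}"
      "\<forall>u\<in>A. \<forall>v\<in>A. (u, v) \<notin> parcs G" "\<forall>u\<in>B. \<forall>v\<in>B. (u, v) \<notin> parcs G"
    using assms(1) unfolding bipartite_def by blast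
  have less: "measure_pmf.prob \<mu> C < measure_pmf.prob \<mu> D"
    if "C \<noteq> {}" "C \<union> D = pverts G" "\<forall>u\<in>C. \<forall>v\<in>C. (u, v) \<notin> parcs G" for C D
  proof -
    have "independent_set G C" using that by (auto simp: independent_set_def)
    then have "measure_pmf.prob \<mu> C < measure_pmf.prob \<mu> (neighbours G C)"
      using assms(2) by (simp add: Ncond_def)
    also have "\<dots> \<le> measure_pmf.prob \<mu> D"
      using that by (intro measure_pmf.finite_measure_mono) (auto simp: neighbours_def)
    finally show ?thesis .
  qed
  have "pverts G \<noteq> {}" using assms(2) set_pmf_not_empty[of \<mu>] by (auto simp: Ncond_def)
  \<comment> \<open>One class may be empty; the other one would then weigh less than the empty
    set.\<close>
  then have "A \<noteq> {} \<or> B \<noteq> {}" using AB(1) by auto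
  moreover have "A \<noteq> {} \<Longrightarrow> measure_pmf.prob \<mu> A < measure_pmf.prob \<mu> B"
    and "B \<noteq> {} \<Longrightarrow> measure_pmf.prob \<mu> B < measure_pmf.prob \<mu> A"
    using less[of A B] less[of B A] AB by (simp_all add: Un_commute)
  ultimately show False
    by (metis less_asym measure_empty measure_nonneg not_less)
qed

text \<open>Arcs are symmetric, so connectedness provides directed walks between all vertices, and a
  walk that starts in \<open>U\<close> never leaves it.\<close>

lemma (in pair_graph) connected_closed:
  assumes "Digraph_Component.connected (with_proj G)"
    and "U \<subseteq> pverts G" "U \<noteq> {}" "\<And>u v. u \<in> U \<Longrightarrow> (u, v) \<in> parcs G \<Longrightarrow> v \<in> U"
  shows "U = pverts G"
proof -
  have "strongly_connected (with_proj G)"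
    using symmetric_connected_imp_strongly_connected[OF pair_sym_arcs assms(1)] .
  then have reach: "u \<rightarrow>\<^sup>*\<^bsub>with_proj G\<^esub> v" if "u \<in> pverts G" "v \<in> pverts G" for u v
    using that by (simp add: strongly_connected_def)
  obtain u where u: "u \<in> U" using assms(3) by blast
  have "v \<in> U" if "v \<in> pverts G" for v
  proof -
    have "u \<rightarrow>\<^sup>*\<^bsub>with_proj G\<^esub> v" using reach u that assms(2) by blast
    then show ?thesis
    proof (induction rule: reachable_induct)
      case base
      then show ?case using u by simp
    next
      case (step x y)
      then show ?case using assms(4) by simp
    qed
  qed
  then show ?thesis using assms(2) by blast
qed

text \<open>Weigh each vertex by its degree: choose an arc uniformly at random and take its tail.\<close>

lemma (in pair_graph) Ncond_nonempty:
  assumes conn: "Digraph_Component.connected (with_proj G)" and "\<not> bipartite G"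
  shows "Ncond G \<noteq> {}"
proof -
  define \<mu> where "\<mu> = map_pmf fst (pmf_of_set (parcs G))"
  \<comment> \<open>Without arcs, the vertex set and the empty set would form a bipartition.\<close>
  have ne: "parcs G \<noteq> {}"
    using \<open>\<not> bipartite G\<close> unfolding bipartite_def by fastforce
  have fin: "finite (parcs G)" by (rule pair_finite_arcs)
  have set: "set_pmf \<mu> = fst ` parcs G" unfolding \<mu>_def using ne fin by simp
  have "fst ` parcs G = pverts G"
  proof (rule connected_closed[OF conn])
    show "v \<in> fst ` parcs G" if "(u, v) \<in> parcs G" for u v
      using arc_sym[OF that] by force
  qed (use ne in \<open>auto dest: in_arcsD1\<close>)
  moreover have prob: "measure_pmf.prob \<mu> A = card {e \<in> parcs G. fst e \<in> A} / card (parcs G)" for A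
    unfolding \<mu>_def using ne fin
    by (simp add: measure_pmf_of_set) (auto intro!: arg_cong[where f = card])
  have "measure_pmf.prob \<mu> I < measure_pmf.prob \<mu> (neighbours G I)" if I: "independent_set G I" for I
  proof -
    let ?N = "neighbours G I"
    \<comment> \<open>Reversing arcs, the weight of \<open>I\<close> counts the arcs with head in
      \<open>I\<close>, and their tails are neighbours of \<open>I\<close>.\<close>
    have sub: "{e \<in> parcs G. snd e \<in> I} \<subseteq> {e \<in> parcs G. fst e \<in> ?N}"
      using arc_sym by (force simp: in_neighbours_iff)
    \<comment> \<open>Equality would send every arc leaving \<open>?N\<close> back into
      \<open>I\<close>. Then \<open>I \<union> ?N\<close> would be closed under arcs, hence the
      whole graph, and \<open>I\<close> and \<open>?N\<close> would be a bipartition.\<close>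
    have "{e \<in> parcs G. snd e \<in> I} \<noteq> {e \<in> parcs G. fst e \<in> ?N}"
    proof
      assume eq: "{e \<in> parcs G. snd e \<in> I} = {e \<in> parcs G. fst e \<in> ?N}"
      have into_I: "v \<in> I" if "(u, v) \<in> parcs G" "u \<in> ?N" for u v
        using that eq by (auto dest!: equalityD2)
      have disj: "I \<inter> ?N = {}" and I': "I \<subseteq> pverts G" "I \<noteq> {}"
          "\<forall>u\<in>I. \<forall>v\<in>I. (u, v) \<notin> parcs G"
        using I by (auto simp: independent_set_def in_neighbours_iff)
      have "I \<union> ?N = pverts G"
      proof (rule connected_closed[OF conn])
        show "v \<in> I \<union> ?N" if "u \<in> I \<union> ?N" "(u, v) \<in> parcs G" for u v
          using that into_I by (auto simp: in_neighbours_iff)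
      qed (use I' in \<open>auto simp: neighbours_def\<close>)
      moreover have "\<forall>u\<in>?N. \<forall>v\<in>?N. (u, v) \<notin> parcs G" using into_I disj by blast
      ultimately have "bipartite G" unfolding bipartite_def using disj I' by blast
      then show False using \<open>\<not> bipartite G\<close> by simp
    qed
    then have "card {e \<in> parcs G. snd e \<in> I} < card {e \<in> parcs G. fst e \<in> ?N}"
      using sub fin by (intro psubset_card_mono) auto
    moreover have "card {e \<in> parcs G. fst e \<in> I} = card {e \<in> parcs G. snd e \<in> I}"
      by (rule bij_betw_same_card[of prod.swap], rule bij_betwI[where g = prod.swap])
         (auto intro: arc_sym)
    ultimately show ?thesis
      unfolding prob using ne fin by (simp add: divide_strict_right_mono card_gt_0_iff)
  qed
  ultimately have "\<mu> \<in> Ncond G" using set by (simp add: Ncond_def)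
  then show ?thesis by blast
qed

theorem theorem2:
  fixes G :: "'a pair_pre_digraph"
  assumes "pair_graph G" and "Digraph_Component.connected (with_proj G)"
  shows
    "(\<not> bipartite G \<longleftrightarrow> (\<exists>\<Phi>\<in>Pol G. \<exists>\<mu>\<in>Ncond G. stable_model G \<Phi> \<mu>)) \<and>
     (\<not> bipartite G \<longrightarrow>
        (\<forall>r. linear_order_on (pverts G) r \<longrightarrow>
           (\<forall>\<Phi>\<in>Match_Longest G r. \<forall>\<mu>\<in>Ncond G. stable_model G \<Phi> \<mu>))) \<and>
     ((\<exists>p\<ge>3. separable G p) \<longrightarrow> (\<forall>\<Phi>\<in>Pol G. \<forall>\<mu>\<in>Ncond G. stable_model G \<Phi> \<mu>))"
proof -
  interpret pair_graph G by fact
  have "\<exists>\<Phi>\<in>Pol G. \<exists>\<mu>\<in>Ncond G. stable_model G \<Phi> \<mu>" if nonbip: "\<not> bipartite G"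
  proof -
    obtain \<mu> where \<mu>: "\<mu> \<in> Ncond G" using Ncond_nonempty[OF assms(2) nonbip] by blast
    \<comment> \<open>Any well-order of the vertices serves as tie-breaking order.\<close>
    obtain r where "well_order_on (pverts G) r" using well_order_on by blast
    then have "linear_order_on (pverts G) r" by (simp add: well_order_on_def)
    then obtain \<Phi> where \<Phi>: "\<Phi> \<in> Match_Longest G r" using Match_Longest_nonempty by blast
    then have "\<Phi> \<in> Pol G" by (simp add: Match_Longest_def)
    then show ?thesis using Match_Longest_stable[OF \<Phi> \<mu>] \<mu> by blast
  qed
  \<comment> \<open>The converse in the first claim holds because \<open>Ncond\<close> is empty for
    a bipartite graph.\<close>
  then show ?thesis
    using Ncond_bipartite Match_Longest_stable separable_stable by blast
qed

end
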